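(* For every $c>c^*$ there exists a monotone function $\phi\in C^2(\mathbb{R},\mathbb{R})$ satisfying $$\phi''(\xi)-c\,\phi'(\xi)-d\,\phi(\xi)+b\big(\phi(\xi-c\,\tau(\phi(\xi)))\big)=0,\qquad \xi\in\mathbb{R},$$ together with $$\lim_{\xi\to-\infty}\phi(\xi)=0,\qquad \lim_{\xi\to+\infty}\phi(\xi)=K.$$
   Context: Setting. $d>0$ is a constant. The birth function $b:[0,\infty)\to[0,\infty)$ satisfies, for some constant $K>0$: $b(0)=0$, $b(K)=dK$, $b(u)>du$ for $u\in(0,K)$, and $0<b(u)<du$ for $u>K$. The delay function $\tau:[0,\infty)\to[0,\infty)$ is $C^1$ on $[0,\infty)$, satisfies $0\le\tau'(u)<1$ for all $u\ge 0$, and $0\le m:=\tau(0)\le\lim_{u\to\infty}\tau(u)=:M<\infty$. Monotone birth function assumptions: $b$ is $C^1$ on $[0,K]$; $b'(0)>d$ and $b(u)<b'(0)u$ for $u\in(0,K]$; $0\le b'(u)\le b'(0)$ for $u\in[0,K]$; and there is $L>0$ such that $0\le b'(0)u-b(u)<Lu^2$ for $u\in(0,K]$. Definition of $c^*$. For $\lambda\ge0$, $c\ge0$ let $\Lambda(\lambda,c)=\lambda^2-c\lambda-d+b'(0)e^{-\lambda c m}$. Then $c^*>0$ is the constant such that $\Lambda(\lambda,c)>0$ for all $\lambda\ge0$ if $c\in[0,c^* )$, while for $c>c^*$ the equation $\Lambda(\lambda,c)=0$ has exactly two distinct positive real roots $\lambda_1(c)<\lambda_2(c)$, with $\Lambda(\cdot,c)<0$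 on $(\lambda_1(c),\lambda_2(c))$ and $\Lambda(\cdot,c)>0$ on $[0,\lambda_1(c))\cup(\lambda_2(c),\infty)$. *)

theory Defs
  imports "HOL-Analysis.Analysis"
begin

text \<open>Characteristic function of the linearization at \<open>0\<close>; the parameter \<open>p\<close> stands for
  \<open>b'(0)\<close> and \<open>m\<close> for \<open>\<tau>(0)\<close>.\<close>

definition char_fun :: "real \<Rightarrow> real \<Rightarrow> real \<Rightarrow> real \<Rightarrow> real \<Rightarrow> real" where
  "char_fun d p m l c = l\<^sup>2 - c * l - d + p * exp (- l * c * m)"

definition is_critical_speed :: "real \<Rightarrow> real \<Rightarrow> real \<Rightarrow> real \<Rightarrow> bool" where
  "is_critical_speed d p m cs \<longleftrightarrow>
     cs > 0 \<and>
     (\<forall>c\<in>{0..<cs}. \<forall>l\<ge>0. char_fun d p m l c > 0) \<and>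
     (\<forall>c>cs. \<exists>l1 l2. 0 < l1 \<and> l1 < l2 \<and>
        {l. l > 0 \<and> char_fun d p m l c = 0} = {l1, l2} \<and>
        (\<forall>l\<in>{l1<..<l2}. char_fun d p m l c < 0) \<and>
        (\<forall>l\<in>{0..<l1} \<union> {l2<..}. char_fun d p m l c > 0))"

definition critical_speed :: "real \<Rightarrow> real \<Rightarrow> real \<Rightarrow> real" where
  "critical_speed d p m = (THE cs. is_critical_speed d p m cs)"

text \<open>The description is proper: the critical speed exists and is unique.\<close>

lemma char_fun_tangent:
  assumes "p \<ge> 0"
  shows "char_fun d p m x c \<ge> char_fun d p m y c
    + (2 * y - c - p * (c * m) * exp (- y * c * m)) * (x - y) + (x - y)\<^sup>2"
proof -
  have "exp (- x * c * m) = exp (- y * c * m) * exp (- (x - y) * c * m)"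
    by (simp flip: exp_add add: algebra_simps)
  moreover have "exp (- (x - y) * c * m) \<ge> 1 + (- (x - y) * c * m)"
    by (rule exp_ge_add_one_self)
  ultimately have "exp (- x * c * m) \<ge> exp (- y * c * m) * (1 + (- (x - y) * c * m))"
    by simp
  then have "p * exp (- x * c * m) \<ge> p * (exp (- y * c * m) * (1 + (- (x - y) * c * m)))"
    using assms by (rule mult_left_mono)
  then show ?thesis
    unfolding char_fun_def by (simp add: algebra_simps power2_eq_square)
qed

lemma char_fun_strict_convex:
  assumes "p \<ge> 0" "x < y" "y < z"
  shows "(z - x) * char_fun d p m y c < (z - y) * char_fun d p m x c + (y - x) * char_fun d p m z c"
proof -
  define F where "F = (\<lambda>l. char_fun d p m l c)"
  define g where "g = 2 * y - c - p * (c * m) * exp (- y * c * m)"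
  have 1: "F x \<ge> F y + g * (x - y) + (x - y)\<^sup>2" and 2: "F z \<ge> F y + g * (z - y) + (z - y)\<^sup>2"
    unfolding F_def g_def using assms(1) by (rule char_fun_tangent)+
  have "(x - y)\<^sup>2 > 0" "(z - y)\<^sup>2 > 0" using assms by auto
  with 1 2 have "F x > F y + g * (x - y)" "F z > F y + g * (z - y)" by linarith+
  then have "(z - y) * F x > (z - y) * (F y + g * (x - y))"
    "(y - x) * F z > (y - x) * (F y + g * (z - y))"
    using assms by auto
  then have "(z - y) * F x + (y - x) * F z
      > (z - y) * (F y + g * (x - y)) + (y - x) * (F y + g * (z - y))"
    by linarith
  also have "(z - y) * (F y + g * (x - y)) + (y - x) * (F y + g * (z - y)) = (z - x) * F y"
    by (simp add: algebra_simps)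
  finally show ?thesis unfolding F_def .
qed

lemma char_fun_antimono:
  assumes "p \<ge> 0" "m \<ge> 0" "l > 0" "c < c'"
  shows "char_fun d p m l c' < char_fun d p m l c"
proof -
  have "c * l < c' * l" using assms by simp
  moreover have "c * (l * m) \<le> c' * (l * m)"
    using assms by (intro mult_right_mono) auto
  then have "exp (- l * c' * m) \<le> exp (- l * c * m)"
    by (simp add: algebra_simps)
  then have "p * exp (- l * c' * m) \<le> p * exp (- l * c * m)"
    using assms by (intro mult_left_mono)
  ultimately show ?thesis unfolding char_fun_def by linarith
qed

lemma char_fun_roots:
  assumes "p > d" "d > 0" "m \<ge> 0" "c \<ge> 0" "l0 \<ge> 0" "char_fun d p m l0 c < 0"
  shows "\<exists>l1 l2. 0 < l1 \<and> l1 < l2 \<and>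
        {l. l > 0 \<and> char_fun d p m l c = 0} = {l1, l2} \<and>
        (\<forall>l\<in>{l1<..<l2}. char_fun d p m l c < 0) \<and>
        (\<forall>l\<in>{0..<l1} \<union> {l2<..}. char_fun d p m l c > 0)"
proof -
  define F where "F = (\<lambda>l. char_fun d p m l c)"
  have cont: "continuous_on S F" for S
    unfolding F_def char_fun_def by (intro continuous_intros)
  have conv: "(z - x) * F y < (z - y) * F x + (y - x) * F z" if "x < y" "y < z" for x y z
    unfolding F_def using char_fun_strict_convex[of p x y z] assms that by auto
  have F0: "F 0 > 0" using assms by (simp add: F_def char_fun_def)
  have Fl0: "F l0 < 0" using assms by (simp add: F_def)
  define R where "R = l0 + c + d + 1"
  have "R * (R - c) \<ge> 1 * (d + 1)"
    using assms unfolding R_def by (intro mult_mono) auto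
  moreover have "p * exp (- R * c * m) > 0" using assms by simp
  ultimately have FR: "F R > 0"
    unfolding F_def char_fun_def by (simp add: power2_eq_square algebra_simps)
  obtain l1 where l1: "0 \<le> l1" "l1 \<le> l0" "F l1 = 0"
    using IVT2'[of F l0 0 0] F0 Fl0 cont assms(5) by auto
  obtain l2 where l2: "l0 \<le> l2" "l2 \<le> R" "F l2 = 0"
    using IVT'[of F l0 0 R] FR Fl0 cont assms by (auto simp: R_def)
  have pos: "0 < l1" "l1 < l2"
    using l1 l2 F0 Fl0 by (auto simp: order_less_le)
  have mid: "F l < 0" if "l1 < l" "l < l2" for l
    using conv[OF that] l1 l2 pos by (auto simp: mult_less_0_iff)
  have left: "F l > 0" if "l < l1" for l
    using conv[OF that pos(2)] l1 l2 pos by (auto simp: zero_less_mult_iff)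
  have right: "F l > 0" if "l > l2" for l
    using conv[OF pos(2) that] l1 l2 pos by (auto simp: zero_less_mult_iff)
  have "{l. l > 0 \<and> F l = 0} = {l1, l2}"
  proof -
    have "l = l1 \<or> l = l2" if "F l = 0" for l
      using mid[of l] left[of l] right[of l] that by force
    then show ?thesis using l1 l2 pos by auto
  qed
  then show ?thesis
    using pos mid left right unfolding F_def by (intro exI[of _ l1] exI[of _ l2]) auto
qed

lemma is_critical_speed_ex1:
  assumes "d > 0" "p > d" "m \<ge> 0"
  shows "\<exists>!cs. is_critical_speed d p m cs"
proof (rule ex_ex1I)
  define A where "A = {c. c \<ge> 0 \<and> (\<exists>l\<ge>0. char_fun d p m l c \<le> 0)}"
  define k where "k = 1 + p * m"
  have k: "k \<ge> 1" using assms by (simp add: k_def)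
  define c0 where "c0 = sqrt (p - d) / k"
  have c0: "c0 > 0" using assms k by (simp add: c0_def)
  have lower: "c \<ge> c0" if "c \<in> A" for c
  proof (rule ccontr)
    assume "\<not> c0 \<le> c"
    then have lt: "c * k < sqrt (p - d)" using k by (simp add: c0_def field_simps)
    from that obtain l where c: "c \<ge> 0" and l: "l \<ge> 0" "char_fun d p m l c \<le> 0"
      by (auto simp: A_def)
    have "p * exp (- l * c * m) \<ge> p * (1 + (- l * c * m))"
      using assms by (intro mult_left_mono exp_ge_add_one_self) auto
    then have "char_fun d p m l c \<ge> l\<^sup>2 - (c * k) * l + (p - d)"
      unfolding char_fun_def k_def by (simp add: algebra_simps)
    moreover have "(c * k)\<^sup>2 < p - d"
      using power_strict_mono[OF lt, of 2] c k assms by simp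
    moreover have "l\<^sup>2 - (c * k) * l = (l - c * k / 2)\<^sup>2 - (c * k)\<^sup>2 / 4"
      by (simp add: power2_eq_square algebra_simps)
    moreover have "(l - c * k / 2)\<^sup>2 \<ge> 0" "(c * k)\<^sup>2 \<ge> 0" by auto
    ultimately show False using l(2) by linarith
  qed
  have "1 + p \<in> A"
  proof -
    define e where "e = exp (- 1 * (1 + p) * m)"
    have "(1 + p) * m \<ge> 0" using assms by simp
    then have "- 1 * (1 + p) * m \<le> 0" by (simp only: mult_minus1 mult_minus_left neg_le_0_iff_le)
    then have "e \<le> 1" unfolding e_def by (simp only: exp_le_one_iff)
    then have "p * e \<le> p"
      using mult_left_mono[of e 1 p] assms by simp
    moreover have "char_fun d p m 1 (1 + p) = p * e - p - d"
      unfolding char_fun_def e_def[symmetric] by simp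
    ultimately have "char_fun d p m 1 (1 + p) \<le> 0"
      using assms by linarith
    then show ?thesis using assms unfolding A_def by (auto intro!: exI[of _ 1])
  qed
  then have ne: "A \<noteq> {}" by blast
  have bdd: "bdd_below A" using lower by (rule bdd_belowI)
  have cs: "Inf A > 0"
    using cInf_greatest[OF ne lower] c0 by linarith
  have below: "char_fun d p m l c > 0" if "0 \<le> c" "c < Inf A" "l \<ge> 0" for c l
    using that cInf_lower[OF _ bdd, of c] unfolding A_def by force
  have above: "\<exists>l\<ge>0. char_fun d p m l c < 0" if "c > Inf A" for c
  proof -
    obtain c' where "c' \<in> A" "c' < c" using cInf_lessD[OF ne \<open>c > Inf A\<close>] by blast
    then obtain l where l: "l \<ge> 0" "char_fun d p m l c' \<le> 0" by (auto simp: A_def)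
    have "l \<noteq> 0" using l(2) assms by (auto simp: char_fun_def)
    then have "char_fun d p m l c < char_fun d p m l c'"
      using assms l \<open>c' < c\<close> by (intro char_fun_antimono) auto
    then show ?thesis using l by force
  qed
  have "is_critical_speed d p m (Inf A)"
    unfolding is_critical_speed_def
  proof (intro conjI ballI allI impI)
    fix c assume c: "c > Inf A"
    obtain l where l: "l \<ge> 0" "char_fun d p m l c < 0" using above[OF c] by blast
    have "c \<ge> 0" using c cs by simp
    from char_fun_roots[OF assms(2,1,3) this l]
    show "\<exists>l1 l2. 0 < l1 \<and> l1 < l2 \<and>
        {l. l > 0 \<and> char_fun d p m l c = 0} = {l1, l2} \<and>
        (\<forall>l\<in>{l1<..<l2}. char_fun d p m l c < 0) \<and>
        (\<forall>l\<in>{0..<l1} \<union> {l2<..}. char_fun d p m l c > 0)" .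
  qed (use cs below in auto)
  then show "\<exists>cs. is_critical_speed d p m cs" by blast
next
  have "\<not> c1 < c2" if "is_critical_speed d p m c1" "is_critical_speed d p m c2" for c1 c2
  proof
    assume "c1 < c2"
    then obtain c where c: "c1 < c" "c < c2" using dense by blast
    have "c1 > 0" using that(1) by (simp add: is_critical_speed_def)
    with c that(2) have pos: "\<forall>l\<ge>0. char_fun d p m l c > 0"
      by (auto simp: is_critical_speed_def)
    from that(1) c(1) obtain l1 l2
      where "{l. l > 0 \<and> char_fun d p m l c = 0} = {l1, l2}"
      unfolding is_critical_speed_def by blast
    then have "l1 > 0" "char_fun d p m l1 c = 0" by blast+
    then show False using spec[OF pos, of l1] by simp
  qed
  then show "x = y" if "is_critical_speed d p m x" "is_critical_speed d p m y" for x y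
    using that by (meson linorder_neqE_linordered_idom)
qed

lemma critical_speed_is_critical:
  assumes "d > 0" "p > d" "m \<ge> 0"
  shows "is_critical_speed d p m (critical_speed d p m)"
  unfolding critical_speed_def by (rule theI') (rule is_critical_speed_ex1[OF assms])

end

theory Submission
  imports Defs
begin

text \<open>Adding \<open>\<beta> \<phi>\<close> to both sides and inverting \<open>\<beta> + c D - D\<^sup>2\<close> turns the wave equation into
  \<open>\<phi> = R (H \<phi>)\<close> with \<open>H \<phi> x = (\<beta> - d) \<phi> x + b (\<phi> (x - c \<tau> (\<phi> x)))\<close>. The delay makes \<open>b (\<phi> (x - c \<tau> (\<phi> x)))\<close>
  non-monotone in \<open>\<phi>\<close>, but among profiles with a common Lipschitz constant \<open>k\<close> the map \<open>H\<close> is monotone as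
  soon as \<open>\<beta> \<ge> d + b'(0) c k\<close>. Writing \<open>\<beta> = a (a + c)\<close>, the operator \<open>R\<close> produces profiles with Lipschitz
  constant \<open>k = a K\<close>, and \<open>a (a + c)\<close> beats \<open>d + b'(0) c a K\<close> for large \<open>a\<close>. So \<open>R \<circ> H\<close> is a monotone self-map
  of the complete lattice of nondecreasing \<open>a K\<close>-Lipschitz profiles between the barriers
  \<open>exp (l x) - q exp (e x)\<close> and \<open>min K (exp (l x))\<close>, where \<open>l = \<lambda>\<^sub>1(c)\<close> and \<open>e\<close> lies slightly above \<open>l\<close>; the
  Knaster-Tarski argument yields a fixed point without any compactness.\<close>

subsection \<open>The resolvent of the constant-coefficient operator\<close>

text \<open>For \<open>r > 0\<close> and bounded continuous \<open>h\<close> this is the bounded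
  solution of \<open>u' = r * u - h\<close>; reflecting the argument gives the one of
  \<open>u' = h - a * u\<close>. These are the two first-order factors of the second-order
  problem.\<close>

definition exp_tail :: "real \<Rightarrow> (real \<Rightarrow> real) \<Rightarrow> real \<Rightarrow> real" where
  "exp_tail r h x = exp (r * x) * integral {x..} (\<lambda>s. exp (- r * s) * h s)"

text \<open>The bounded solution \<open>u\<close> of \<open>u'' - (r - a) u' - a r u + h = 0\<close>; the characteristic roots are \<open>- a\<close> and \<open>r\<close>.\<close>

definition resolvent :: "real \<Rightarrow> real \<Rightarrow> (real \<Rightarrow> real) \<Rightarrow> real \<Rightarrow> real" where
  "resolvent a r h x = (exp_tail a (\<lambda>s. h (- s)) (- x) + exp_tail r h x) / (a + r)"

lemma exp_tail_integrable:
  fixes r x C :: real and h :: "real \<Rightarrow> real"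
  assumes "r > 0" "continuous_on UNIV h" "\<And>x. \<bar>h x\<bar> \<le> C"
  shows "(\<lambda>s. exp (- r * s) * h s) integrable_on {x..}"
proof (rule measurable_bounded_by_integrable_imp_integrable_real[where g = "\<lambda>s. C * exp (- r * s)"])
  have "continuous_on {x..} (\<lambda>s. exp (- r * s) * h s)"
    by (intro continuous_intros continuous_on_subset[OF assms(2)]) auto
  then show "(\<lambda>s. exp (- r * s) * h s) \<in> borel_measurable (lebesgue_on {x..})"
    by (intro continuous_imp_measurable_on_sets_lebesgue) auto
  show "(\<lambda>s. C * exp (- r * s)) integrable_on {x..}"
    using integrable_on_exp_minus_to_infinity[OF assms(1)] by (intro integrable_on_mult_right) auto
  show "\<bar>exp (- r * s) * h s\<bar> \<le> C * exp (- r * s)" for s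
    using assms(3)[of s] by (simp add: abs_mult mult.commute)
qed auto

lemma exp_tail_mono:
  assumes "r > 0" "continuous_on UNIV h" "\<And>x. \<bar>h x\<bar> \<le> C"
    "continuous_on UNIV k" "\<And>x. \<bar>k x\<bar> \<le> D" "\<And>s. s \<ge> x \<Longrightarrow> h s \<le> k s"
  shows "exp_tail r h x \<le> exp_tail r k x"
  unfolding exp_tail_def
  using exp_tail_integrable[OF assms(1-3)] exp_tail_integrable[OF assms(1,4,5)] assms(6)
  by (intro mult_left_mono integral_le) auto

text \<open>Sums of two exponentials cover every comparison function used later: the barriers, and
  constants as the case of exponent 0.\<close>

lemma exp_tail_exp_integral:
  fixes r l e A B x :: real
  assumes "l < r" "e < r"
  shows "((\<lambda>s. exp (- r * s) * (A * exp (l * s) + B * exp (e * s))) has_integral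
    exp (- r * x) * (A * exp (l * x) / (r - l) + B * exp (e * x) / (r - e))) {x..}"
proof -
  have "((\<lambda>s. A * exp (- (r - l) * s) + B * exp (- (r - e) * s)) has_integral
    A * (exp (- (r - l) * x) / (r - l)) + B * (exp (- (r - e) * x) / (r - e))) {x..}"
    using has_integral_exp_minus_to_infinity[of "r - l" x] has_integral_exp_minus_to_infinity[of "r - e" x] assms
    by (intro has_integral_add has_integral_mult_right) simp_all
  moreover have "A * exp (- (r - l) * s) = exp (- r * s) * (A * exp (l * s))" for A l s
    by (simp add: algebra_simps flip: exp_add)
  moreover have "A * (exp (- (r - l) * s) / k) = exp (- r * s) * (A * exp (l * s) / k)" for A l s k
    by (simp add: algebra_simps flip: exp_add)
  ultimately show ?thesis
    by (simp only: distrib_left)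
qed

lemma exp_tail_le:
  assumes "r > 0" "continuous_on UNIV h" "\<And>x. \<bar>h x\<bar> \<le> C" "l < r" "e < r"
    "\<And>s. s \<ge> x \<Longrightarrow> h s \<le> A * exp (l * s) + B * exp (e * s)"
  shows "exp_tail r h x \<le> A * exp (l * x) / (r - l) + B * exp (e * x) / (r - e)"
proof -
  have "integral {x..} (\<lambda>s. exp (- r * s) * h s)
    \<le> exp (- r * x) * (A * exp (l * x) / (r - l) + B * exp (e * x) / (r - e))"
    using exp_tail_exp_integral[OF assms(4,5)] assms(6)
    by (intro has_integral_le[OF integrable_integral[OF exp_tail_integrable[OF assms(1-3)]]]) auto
  then have "exp_tail r h x
    \<le> exp (r * x) * (exp (- r * x) * (A * exp (l * x) / (r - l) + B * exp (e * x) / (r - e)))"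
    unfolding exp_tail_def by (intro mult_left_mono) auto
  also have "\<dots> = exp (r * x + - r * x) * (A * exp (l * x) / (r - l) + B * exp (e * x) / (r - e))"
    by (simp only: exp_add mult.assoc)
  finally show ?thesis by simp
qed

lemma exp_tail_minus: "exp_tail r (\<lambda>s. - h s) x = - exp_tail r h x"
  by (simp add: exp_tail_def)

lemma exp_tail_ge:
  assumes "r > 0" "continuous_on UNIV h" "\<And>x. \<bar>h x\<bar> \<le> C" "l < r" "e < r"
    "\<And>s. s \<ge> x \<Longrightarrow> h s \<ge> A * exp (l * s) + B * exp (e * s)"
  shows "exp_tail r h x \<ge> A * exp (l * x) / (r - l) + B * exp (e * x) / (r - e)"
proof -
  have "exp_tail r (\<lambda>s. - h s) x \<le> - A * exp (l * x) / (r - l) + - B * exp (e * x) / (r - e)"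
  proof (rule exp_tail_le[where C = C])
    show "- h s \<le> - A * exp (l * s) + - B * exp (e * s)" if "s \<ge> x" for s
      using assms(6)[OF that] by simp
  qed (use assms in \<open>auto intro!: continuous_intros\<close>)
  then show ?thesis by (simp add: exp_tail_minus)
qed

lemma exp_tail_deriv:
  assumes "r > 0" "continuous_on UNIV h" "\<And>x. \<bar>h x\<bar> \<le> C"
  shows "(exp_tail r h has_real_derivative r * exp_tail r h x - h x) (at x)"
proof -
  define g where "g = (\<lambda>s. exp (- r * s) * h s)"
  define J where "J = (\<lambda>y. integral {y..} g)"
  have int: "g integrable_on {y..}" for y
    unfolding g_def by (rule exp_tail_integrable[OF assms])
  have cont: "continuous_on S g" for S
    unfolding g_def by (intro continuous_intros continuous_on_subset[OF assms(2)]) auto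
  \<comment> \<open>For \<open>y\<close> near \<open>x\<close> only the piece up to
    \<open>x + 1\<close> varies, so the fundamental theorem on a compact interval differentiates the
    improper integral.\<close>
  have J: "J y = integral {y..x + 1} g + J (x + 1)" if "y \<le> x + 1" for y
  proof -
    have "{y..} = {y..x + 1} \<union> {x + 1..}" using that by auto
    moreover have "{y..x + 1} \<inter> {x + 1..} = {x + 1}" using that by auto
    ultimately show ?thesis
      unfolding J_def using int integrable_continuous_interval[OF cont] by simp
  qed
  have "((\<lambda>y. integral {y..x + 1} g) has_real_derivative - g x) (at x within {x - 1..x + 1})"
    by (rule integral_has_real_derivative'[OF cont]) auto
  then have "((\<lambda>y. integral {y..x + 1} g) has_real_derivative - g x) (at x)"
    using at_within_Icc_at[of "x - 1" x "x + 1"] by simp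
  then have "((\<lambda>y. integral {y..x + 1} g + J (x + 1)) has_real_derivative - g x + 0) (at x)"
    by (intro DERIV_add DERIV_const)
  then have "(J has_real_derivative - g x + 0) (at x)"
    by (rule has_field_derivative_transform_within[where d = 1])
      (auto simp: dist_real_def intro!: J[symmetric])
  then have "((\<lambda>y. exp (r * y) * J y) has_real_derivative
      r * (exp (r * x) * J x) - exp (r * x) * g x) (at x)"
    by (auto intro!: derivative_eq_intros)
  moreover have "exp (r * x) * g x = h x"
    unfolding g_def by (simp flip: mult.assoc exp_add)
  moreover have "exp_tail r h = (\<lambda>y. exp (r * y) * J y)"
    by (simp add: fun_eq_iff exp_tail_def J_def g_def)
  ultimately show ?thesis
    by simp
qed

section \<open>Comparison principles for the resolvent\<close>

text \<open>\<open>(a + l) * (r - l)\<close> is the factor by which the operator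
  \<open>a r + (r - a) D - D^2\<close> multiplies \<open>exp (l x)\<close>. The partial fraction
  split of its inverse shows that the resolvent undoes this factor.\<close>

lemma resolvent_exp_identity:
  fixes a r l A :: real
  assumes "- a < l" "l < r"
  shows "A * ((a + l) * (r - l)) / (a + l) + A * ((a + l) * (r - l)) / (r - l) = (a + r) * A"
proof -
  have "a + l \<noteq> 0" "r - l \<noteq> 0" using assms by auto
  then have "A * ((a + l) * (r - l)) / (a + l) = A * (r - l)"
    "A * ((a + l) * (r - l)) / (r - l) = A * (a + l)"
    by simp_all
  then show ?thesis by (simp add: algebra_simps)
qed

context
  fixes a r C :: real and h :: "real \<Rightarrow> real"
  assumes a: "a > 0" and r: "r > 0"
    and h: "continuous_on UNIV h" "\<And>x. \<bar>h x\<bar> \<le> C"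
begin

lemma continuous_on_reflect: "continuous_on UNIV (\<lambda>s. h (- s))"
  by (rule continuous_on_compose2[OF h(1)]) (auto intro!: continuous_intros)

lemma resolvent_mono:
  assumes "continuous_on UNIV k" "\<And>x. \<bar>k x\<bar> \<le> D" "\<And>s. h s \<le> k s"
  shows "resolvent a r h x \<le> resolvent a r k x"
proof -
  have "continuous_on UNIV (\<lambda>s. k (- s))"
    by (rule continuous_on_compose2[OF assms(1)]) (auto intro!: continuous_intros)
  then have "exp_tail a (\<lambda>s. h (- s)) (- x) \<le> exp_tail a (\<lambda>s. k (- s)) (- x)"
    using a h continuous_on_reflect assms by (intro exp_tail_mono[where C = C and D = D]) auto
  moreover have "exp_tail r h x \<le> exp_tail r k x"
    using r h assms by (intro exp_tail_mono[where C = C and D = D]) auto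
  ultimately show ?thesis
    unfolding resolvent_def using a r by (intro divide_right_mono) auto
qed

text \<open>The kernel is nonnegative, and for exponents strictly between the characteristic roots
  \<open>- a\<close> and \<open>r\<close> the resolvent reproduces the exponentials; so a
  differential inequality becomes a pointwise bound.\<close>

lemma resolvent_le:
  assumes "- a < l" "l < r" "- a < e" "e < r"
    "\<And>s. h s \<le> A * ((a + l) * (r - l)) * exp (l * s) + B * ((a + e) * (r - e)) * exp (e * s)"
  shows "resolvent a r h x \<le> A * exp (l * x) + B * exp (e * x)"
proof -
  define A' B' where "A' = A * ((a + l) * (r - l))" and "B' = B * ((a + e) * (r - e))"
  have "exp_tail a (\<lambda>s. h (- s)) (- x) \<le> A' * exp (- l * - x) / (a - - l) + B' * exp (- e * - x) / (a - - e)"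
    using a h assms continuous_on_reflect assms(5)[of "- s" for s]
    unfolding A'_def[symmetric] B'_def[symmetric]
    by (intro exp_tail_le[where C = C]) auto
  moreover have "exp_tail r h x \<le> A' * exp (l * x) / (r - l) + B' * exp (e * x) / (r - e)"
    using r h assms unfolding A'_def[symmetric] B'_def[symmetric]
    by (intro exp_tail_le[where C = C]) auto
  ultimately have "exp_tail a (\<lambda>s. h (- s)) (- x) + exp_tail r h x \<le>
      (A' / (a + l) + A' / (r - l)) * exp (l * x) + (B' / (a + e) + B' / (r - e)) * exp (e * x)"
    by (simp add: algebra_simps)
  also have "\<dots> = (A * exp (l * x) + B * exp (e * x)) * (a + r)"
    unfolding A'_def B'_def resolvent_exp_identity[OF assms(1,2)] resolvent_exp_identity[OF assms(3,4)]
    by (simp add: algebra_simps)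
  finally show ?thesis
    unfolding resolvent_def using a r by (simp add: pos_divide_le_eq)
qed

lemma resolvent_ge:
  assumes "- a < l" "l < r" "- a < e" "e < r"
    "\<And>s. h s \<ge> A * ((a + l) * (r - l)) * exp (l * s) + B * ((a + e) * (r - e)) * exp (e * s)"
  shows "resolvent a r h x \<ge> A * exp (l * x) + B * exp (e * x)"
proof -
  define A' B' where "A' = A * ((a + l) * (r - l))" and "B' = B * ((a + e) * (r - e))"
  have "exp_tail a (\<lambda>s. h (- s)) (- x) \<ge> A' * exp (- l * - x) / (a - - l) + B' * exp (- e * - x) / (a - - e)"
    using a h assms continuous_on_reflect assms(5)[of "- s" for s]
    unfolding A'_def[symmetric] B'_def[symmetric]
    by (intro exp_tail_ge[where C = C]) auto
  moreover have "exp_tail r h x \<ge> A' * exp (l * x) / (r - l) + B' * exp (e * x) / (r - e)"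
    using r h assms unfolding A'_def[symmetric] B'_def[symmetric]
    by (intro exp_tail_ge[where C = C]) auto
  ultimately have "exp_tail a (\<lambda>s. h (- s)) (- x) + exp_tail r h x \<ge>
      (A' / (a + l) + A' / (r - l)) * exp (l * x) + (B' / (a + e) + B' / (r - e)) * exp (e * x)"
    by (simp add: algebra_simps)
  also have "(A' / (a + l) + A' / (r - l)) * exp (l * x) + (B' / (a + e) + B' / (r - e)) * exp (e * x)
      = (A * exp (l * x) + B * exp (e * x)) * (a + r)"
    unfolding A'_def B'_def resolvent_exp_identity[OF assms(1,2)] resolvent_exp_identity[OF assms(3,4)]
    by (simp add: algebra_simps)
  finally show ?thesis
    unfolding resolvent_def using a r by (simp add: pos_le_divide_eq)
qed

section \<open>First and second derivative of the resolvent\<close>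

text \<open>When the two tails are differentiated, the terms \<open>h x\<close> cancel. The first
  derivative is therefore again a combination of tails and can be differentiated once more, although
  \<open>h\<close> is merely continuous.\<close>

definition resolvent_slope :: "real \<Rightarrow> real" where
  "resolvent_slope x = (r * exp_tail r h x - a * exp_tail a (\<lambda>s. h (- s)) (- x)) / (a + r)"

lemma exp_tail_reflect_deriv:
  "((\<lambda>y. exp_tail a (\<lambda>s. h (- s)) (- y)) has_real_derivative
     h x - a * exp_tail a (\<lambda>s. h (- s)) (- x)) (at x)"
proof -
  have "(exp_tail a (\<lambda>s. h (- s)) has_real_derivative
    a * exp_tail a (\<lambda>s. h (- s)) (- x) - h (- (- x))) (at (- x))"
    using a h continuous_on_reflect by (intro exp_tail_deriv[where C = C]) auto
  moreover have "((\<lambda>y. - y) has_real_derivative - 1) (at x)"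
    by (auto intro!: derivative_eq_intros)
  ultimately have "((\<lambda>y. exp_tail a (\<lambda>s. h (- s)) (- y)) has_real_derivative
     (a * exp_tail a (\<lambda>s. h (- s)) (- x) - h (- (- x))) * - 1) (at x)"
    by (rule DERIV_chain2)
  then show ?thesis by simp
qed

lemma resolvent_deriv: "(resolvent a r h has_real_derivative resolvent_slope x) (at x)"
proof -
  have "(resolvent a r h has_real_derivative
     ((h x - a * exp_tail a (\<lambda>s. h (- s)) (- x)) + (r * exp_tail r h x - h x)) / (a + r)) (at x)"
    unfolding resolvent_def[abs_def]
    by (intro DERIV_cdivide DERIV_add exp_tail_reflect_deriv exp_tail_deriv[OF r h])
  then show ?thesis by (simp add: resolvent_slope_def)
qed

lemma resolvent_slope_deriv:
  "(resolvent_slope has_real_derivative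
     (r - a) * resolvent_slope x + a * r * resolvent a r h x - h x) (at x)"
proof -
  have ar: "a + r > 0" using a r by simp
  have "(resolvent_slope has_real_derivative
     (r * (r * exp_tail r h x - h x) - a * (h x - a * exp_tail a (\<lambda>s. h (- s)) (- x))) / (a + r)) (at x)"
    unfolding resolvent_slope_def[abs_def]
    by (intro DERIV_cdivide DERIV_diff DERIV_cmult exp_tail_reflect_deriv exp_tail_deriv[OF r h])
  moreover have "(r * (r * q - k) - a * (k - a * p)) / (a + r)
     = (r - a) * ((r * q - a * p) / (a + r)) + a * r * ((p + q) / (a + r)) - k" for p q k
    using ar by (simp add: divide_simps) (simp add: algebra_simps)
  ultimately show ?thesis
    unfolding resolvent_slope_def resolvent_def by simp
qed

text \<open>\<open>r * exp_tail r h x\<close> is a weighted mean of \<open>h\<close> over the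
  half-line right of \<open>x\<close>, the reflected term a mean over the half-line to the left; for
  nondecreasing \<open>h\<close> the value \<open>h x\<close> separates the two.\<close>

lemma resolvent_slope_nonneg:
  assumes "mono h"
  shows "resolvent_slope x \<ge> 0"
proof -
  have "exp_tail r h x \<ge> h x * exp (0 * x) / (r - 0) + 0 * exp (0 * x) / (r - 0)"
    using r h monoD[OF assms] by (intro exp_tail_ge[where C = C]) auto
  then have 1: "r * exp_tail r h x \<ge> h x"
    using r by (simp add: field_simps)
  have "exp_tail a (\<lambda>s. h (- s)) (- x) \<le> h x * exp (0 * - x) / (a - 0) + 0 * exp (0 * - x) / (a - 0)"
    using a h continuous_on_reflect monoD[OF assms] by (intro exp_tail_le[where C = C]) auto
  then have "a * exp_tail a (\<lambda>s. h (- s)) (- x) \<le> h x"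
    using a by (simp add: field_simps)
  with 1 show ?thesis
    unfolding resolvent_slope_def using a r by simp
qed

lemma resolvent_slope_le:
  assumes "\<And>x. 0 \<le> h x" "\<And>x. h x \<le> D"
  shows "resolvent_slope x \<le> D / (a + r)"
proof -
  have "exp_tail r h x \<le> D * exp (0 * x) / (r - 0) + 0 * exp (0 * x) / (r - 0)"
    using r h assms by (intro exp_tail_le[where C = C]) auto
  then have 1: "r * exp_tail r h x \<le> D"
    using r by (simp add: field_simps)
  have "exp_tail a (\<lambda>s. h (- s)) (- x) \<ge> 0 * exp (0 * - x) / (a - 0) + 0 * exp (0 * - x) / (a - 0)"
    using a h continuous_on_reflect assms by (intro exp_tail_ge[where C = C]) auto
  then have "a * exp_tail a (\<lambda>s. h (- s)) (- x) \<ge> 0"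
    using a by simp
  with 1 show ?thesis
    unfolding resolvent_slope_def using a r by (intro divide_right_mono) auto
qed

end

subsection \<open>The monotone wave operator\<close>

lemma continuous_on_mono_lipschitz:
  fixes f :: "real \<Rightarrow> real"
  assumes "k \<ge> 0"
    "\<And>x y. x \<in> S \<Longrightarrow> y \<in> S \<Longrightarrow> x \<le> y \<Longrightarrow> f x \<le> f y \<and> f y \<le> f x + k * (y - x)"
  shows "continuous_on S f"
proof (rule lipschitz_on_continuous_on)
  show "k-lipschitz_on S f"
  proof (rule lipschitz_onI)
    show "dist (f x) (f y) \<le> k * dist x y" if "x \<in> S" "y \<in> S" for x y
      using assms(2)[of x y] assms(2)[of y x] that by (cases "x \<le> y") (auto simp: dist_real_def)
  qed (fact assms)
qed

text \<open>The derivative hypotheses enter as monotonicity and Lipschitz bounds, with constant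
  \<open>p\<close> for \<open>b\<close> and 1 for \<open>\<tau>\<close>. \<open>a_large\<close>
  makes \<open>nonlin\<close> monotone. For the lower barrier, \<open>q_char\<close> serves on the
  negative half-line, \<open>q_symbol\<close> on the nonnegative one, and \<open>q_cutoff\<close>
  keeps it below \<open>K\<close>.\<close>

locale delayed_wave =
  fixes d K L p c a l e q :: real and b \<tau> :: "real \<Rightarrow> real"
  assumes d: "d > 0" and K: "K > 0" and L: "L \<ge> 0" and p: "p \<ge> 0" and c: "c > 0" and a: "a > 0"
    and l: "0 < l" "l \<le> a" and e: "l < e" "e \<le> 2 * l" "e < a + c"
    and b_0: "b 0 = 0" and b_K: "b K = d * K"
    and b_gt: "0 < u \<Longrightarrow> u < K \<Longrightarrow> b u > d * u"
    and b_mono: "0 \<le> u \<Longrightarrow> u \<le> v \<Longrightarrow> v \<le> K \<Longrightarrow> b u \<le> b v"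
    and b_lipschitz: "0 \<le> u \<Longrightarrow> u \<le> v \<Longrightarrow> v \<le> K \<Longrightarrow> b v \<le> b u + p * (v - u)"
    and b_ge: "0 \<le> u \<Longrightarrow> u \<le> K \<Longrightarrow> p * u - L * u\<^sup>2 \<le> b u"
    and tau_0: "\<tau> 0 \<ge> 0"
    and tau_mono: "0 \<le> u \<Longrightarrow> u \<le> v \<Longrightarrow> \<tau> u \<le> \<tau> v"
    and tau_lipschitz: "0 \<le> u \<Longrightarrow> u \<le> v \<Longrightarrow> \<tau> v \<le> \<tau> u + (v - u)"
    and a_large: "d + p * c * (a * K) \<le> a * (a + c)"
    and char_l: "char_fun d p (\<tau> 0) l c = 0"
    and q: "q \<ge> 0"
    and q_char: "p * l * c + L \<le> - q * char_fun d p (\<tau> 0) e c"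
    and q_symbol: "(a + l) * (a + c - l) \<le> q * ((a + e) * (a + c - e))"
    and q_cutoff: "K \<le> exp (l * x) \<Longrightarrow> exp (l * x) \<le> q * exp (e * x)"
begin

definition nonlin :: "(real \<Rightarrow> real) \<Rightarrow> real \<Rightarrow> real" where
  "nonlin \<phi> x = (a * (a + c) - d) * \<phi> x + b (\<phi> (x - c * \<tau> (\<phi> x)))"

definition wave_map :: "(real \<Rightarrow> real) \<Rightarrow> real \<Rightarrow> real" where
  "wave_map \<phi> = resolvent a (a + c) (nonlin \<phi>)"

definition admissible :: "(real \<Rightarrow> real) \<Rightarrow> bool" where
  "admissible \<phi> \<longleftrightarrow> mono \<phi> \<and> (\<forall>x y. x \<le> y \<longrightarrow> \<phi> y \<le> \<phi> x + a * K * (y - x)) \<and>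
     (\<forall>x. 0 \<le> \<phi> x \<and> \<phi> x \<le> K)"

definition trapped :: "(real \<Rightarrow> real) \<Rightarrow> bool" where
  "trapped \<phi> \<longleftrightarrow> (\<forall>x. exp (l * x) - q * exp (e * x) \<le> \<phi> x \<and> \<phi> x \<le> exp (l * x))"

lemma a_large': "p * c * (a * K) \<le> a * (a + c) - d"
  using a_large by simp

lemma symbol_nonneg: "0 \<le> a * (a + c) - d"
proof -
  have "0 \<le> p * c * (a * K)" using p c a K by simp
  then show ?thesis using a_large' by linarith
qed

lemma tau_nonneg: "0 \<le> u \<Longrightarrow> 0 \<le> \<tau> u"
  using tau_mono[of 0 u] tau_0 by simp

lemma b_range: "0 \<le> u \<Longrightarrow> u \<le> K \<Longrightarrow> 0 \<le> b u \<and> b u \<le> d * K"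
  using b_mono[of 0 u] b_mono[of u K] b_0 b_K by simp

lemma b_le: "0 \<le> u \<Longrightarrow> u \<le> K \<Longrightarrow> b u \<le> p * u"
  using b_lipschitz[of 0 u] b_0 by simp

text \<open>On \<open>exp (y x)\<close>, the linearization of \<open>nonlin\<close> at 0 with the
  delay frozen at \<open>\<tau> 0\<close> acts as the factor
  \<open>(a * (a + c) - d) + p * exp (- y * c * \<tau> 0)\<close>, the inverse of the resolvent as
  the factor on the left. The characteristic function is their difference, so at a root the
  linearized wave map fixes \<open>exp (y x)\<close>.\<close>

lemma symbol_eq: "(a + y) * (a + c - y) = (a * (a + c) - d) + p * exp (- y * c * \<tau> 0) - char_fun d p (\<tau> 0) y c"
  unfolding char_fun_def by (simp add: algebra_simps power2_eq_square)

text \<open>Raising the profile lengthens the delay and so lowers the birth term; the Lipschitz bound on the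
  larger profile lets the linear term absorb this loss. With \<open>\<psi> = \<phi>\<close> the lemma yields monotonicity of
  \<open>nonlin \<phi>\<close> in space, with \<open>x = y\<close> monotonicity in the profile.\<close>

lemma nonlin_le:
  assumes "admissible \<phi>" "admissible \<psi>" "\<And>s. s \<ge> 0 \<Longrightarrow> \<phi> (x - s) \<le> \<psi> (y - s)"
  shows "nonlin \<phi> x \<le> nonlin \<psi> y"
proof -
  define u v where "u = \<phi> x" and "v = \<psi> y"
  \<comment> \<open>The passage from \<open>\<phi>\<close> to \<open>\<psi>\<close> is split: first
    the profile is raised with the delay kept at \<open>\<tau> u\<close>, which leads to
    \<open>z\<close>, then the delay is lengthened to \<open>\<tau> v\<close>, which leads to
    \<open>w\<close>.\<close>
  define z w where "z = \<psi> (y - c * \<tau> u)" and "w = \<psi> (y - c * \<tau> v)"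
  have uv: "0 \<le> u" "u \<le> v" "v \<le> K"
    using assms(1,2) assms(3)[of 0] by (auto simp: u_def v_def admissible_def)
  have \<tau>: "0 \<le> c * \<tau> u" "c * \<tau> u \<le> c * \<tau> v" "c * \<tau> v - c * \<tau> u \<le> c * (v - u)"
    using c uv tau_mono[of u v] tau_nonneg[of u] mult_left_mono[OF tau_lipschitz[of u v], of c]
    by (auto simp: algebra_simps)
  have z: "0 \<le> z" "z \<le> K" "0 \<le> w" "w \<le> z"
    using assms(2) \<tau> by (auto simp: z_def w_def admissible_def intro: monoD)
  have lip: "\<psi> t \<le> \<psi> s + a * K * (t - s)" if "s \<le> t" for s t
    using assms(2) that by (simp add: admissible_def)
  have "z \<le> w + a * K * ((y - c * \<tau> u) - (y - c * \<tau> v))"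
    unfolding z_def w_def using \<tau>(2) by (intro lip) simp
  also have "\<dots> \<le> w + a * K * (c * (v - u))"
    using \<tau> a K by (intro add_left_mono mult_left_mono) auto
  finally have zw: "z - w \<le> a * K * (c * (v - u))" by simp
  have "b (\<phi> (x - c * \<tau> u)) \<le> b z"
    using assms(1) assms(3)[OF \<tau>(1)] z(2) by (intro b_mono) (auto simp: z_def admissible_def)
  also have "b z \<le> b w + p * (z - w)"
    using z by (intro b_lipschitz) auto
  also have "\<dots> \<le> b w + p * (a * K * (c * (v - u)))"
    using zw p by (intro add_left_mono mult_left_mono)
  also have "p * (a * K * (c * (v - u))) = p * c * (a * K) * (v - u)" by simp
  also have "\<dots> \<le> (a * (a + c) - d) * (v - u)"
    using a_large' uv by (intro mult_right_mono) auto
  finally have "b (\<phi> (x - c * \<tau> u)) \<le> b w + (a * (a + c) - d) * (v - u)" by simp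
  then show ?thesis
    unfolding nonlin_def w_def u_def[symmetric] v_def[symmetric] by (simp add: right_diff_distrib)
qed

section \<open>Invariance of the admissible profiles\<close>

context
  fixes \<phi> :: "real \<Rightarrow> real"
  assumes adm: "admissible \<phi>"
begin

lemma admissibleD:
  "mono \<phi>" "x \<le> y \<Longrightarrow> \<phi> x \<le> \<phi> y" "x \<le> y \<Longrightarrow> \<phi> y \<le> \<phi> x + a * K * (y - x)" "0 \<le> \<phi> x" "\<phi> x \<le> K"
  using adm by (auto simp: admissible_def monoD)

lemma admissible_continuous: "continuous_on S \<phi>"
  using a K by (intro continuous_on_mono_lipschitz[where k = "a * K"]) (auto intro: admissibleD)

lemma birth_continuous: "continuous_on S (\<lambda>x. b (\<phi> (x - c * \<tau> (\<phi> x))))"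
proof -
  have b: "continuous_on {0..K} b"
    using p by (rule continuous_on_mono_lipschitz) (auto intro: b_mono b_lipschitz)
  have \<tau>: "continuous_on {0..} \<tau>"
    by (rule continuous_on_mono_lipschitz[where k = 1]) (auto intro: tau_mono dest: tau_lipschitz)
  have "continuous_on S (\<lambda>x. \<tau> (\<phi> x))"
    by (rule continuous_on_compose2[OF \<tau> admissible_continuous]) (auto intro: admissibleD)
  then have "continuous_on S (\<lambda>x. \<phi> (x - c * \<tau> (\<phi> x)))"
    by (intro continuous_on_compose2[OF admissible_continuous[of UNIV]] continuous_intros) auto
  then show ?thesis
    by (rule continuous_on_compose2[OF b]) (auto intro: admissibleD)
qed

lemma nonlin_continuous: "continuous_on UNIV (nonlin \<phi>)"
  unfolding nonlin_def[abs_def]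
  by (intro continuous_intros birth_continuous admissible_continuous)

lemma nonlin_range: "0 \<le> nonlin \<phi> x" "nonlin \<phi> x \<le> a * (a + c) * K"
proof -
  have 1: "0 \<le> b (\<phi> (x - c * \<tau> (\<phi> x)))" "b (\<phi> (x - c * \<tau> (\<phi> x))) \<le> d * K"
    using b_range admissibleD by auto
  have 2: "0 \<le> (a * (a + c) - d) * \<phi> x" "(a * (a + c) - d) * \<phi> x \<le> (a * (a + c) - d) * K"
    using symbol_nonneg admissibleD by (auto intro: mult_left_mono)
  show "0 \<le> nonlin \<phi> x" using 1 2 by (simp add: nonlin_def)
  show "nonlin \<phi> x \<le> a * (a + c) * K" using 1 2 by (simp add: nonlin_def left_diff_distrib)
qed

lemma nonlin_abs: "\<bar>nonlin \<phi> x\<bar> \<le> a * (a + c) * K"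
  using nonlin_range[of x] by simp

lemma nonlin_mono: "mono (nonlin \<phi>)"
  using adm by (intro monoI nonlin_le) (auto intro: admissibleD)

lemma ac: "a + c > 0" using a c by simp

definition wave_slope :: "real \<Rightarrow> real" where
  "wave_slope = resolvent_slope a (a + c) (nonlin \<phi>)"

lemma wave_map_deriv: "(wave_map \<phi> has_real_derivative wave_slope x) (at x)"
  unfolding wave_map_def wave_slope_def
  by (rule resolvent_deriv[OF a ac nonlin_continuous nonlin_abs])

lemma wave_slope_deriv:
  "(wave_slope has_real_derivative c * wave_slope x + a * (a + c) * wave_map \<phi> x - nonlin \<phi> x) (at x)"
  using resolvent_slope_deriv[OF a ac nonlin_continuous nonlin_abs]
  unfolding wave_map_def wave_slope_def by simp

text \<open>This bound explains the Lipschitz constant \<open>a * K\<close> in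
  \<open>admissible\<close>: the source is at most \<open>a * (a + c) * K\<close>, and dividing by
  \<open>2 * a + c\<close> leaves at most \<open>a * K\<close>.\<close>

lemma wave_slope_range: "0 \<le> wave_slope x" "wave_slope x \<le> a * K"
proof -
  show "0 \<le> wave_slope x"
    unfolding wave_slope_def
    by (rule resolvent_slope_nonneg[OF a ac nonlin_continuous nonlin_abs nonlin_mono])
  have "wave_slope x \<le> a * (a + c) * K / (a + (a + c))"
    unfolding wave_slope_def
    by (rule resolvent_slope_le[OF a ac nonlin_continuous nonlin_abs nonlin_range])
  also have "\<dots> \<le> a * K"
    using a c K by (simp add: divide_simps algebra_simps)
  finally show "wave_slope x \<le> a * K" .
qed

lemma wave_map_admissible: "admissible (wave_map \<phi>)"
  unfolding admissible_def
proof (intro conjI allI impI)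
  have "a > 0" "a + c > 0" using a c by auto
  \<comment> \<open>Exponent 0 has symbol \<open>a * (a + c)\<close>, so the comparison principles
    apply with the constants 0 and \<open>K\<close>.\<close>
  note R = resolvent_ge[OF this nonlin_continuous nonlin_abs, of 0 0 0 0]
    resolvent_le[OF this nonlin_continuous nonlin_abs, of 0 0 K 0]
  show "0 \<le> wave_map \<phi> x" "wave_map \<phi> x \<le> K" for x
    using R[of x] a c nonlin_range by (auto simp: wave_map_def algebra_simps)
  have *: "wave_map \<phi> x \<le> wave_map \<phi> y \<and> wave_map \<phi> y \<le> wave_map \<phi> x + a * K * (y - x)"
    if xy: "x < y" for x y
  proof -
    obtain z where z: "wave_map \<phi> y - wave_map \<phi> x = (y - x) * wave_slope z"
      using MVT2[OF xy, of "wave_map \<phi>" wave_slope] wave_map_deriv by blast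
    moreover have "0 \<le> (y - x) * wave_slope z" "(y - x) * wave_slope z \<le> (y - x) * (a * K)"
      using xy wave_slope_range[of z] by (auto intro: mult_left_mono)
    ultimately show ?thesis by (simp add: mult.commute)
  qed
  then show "mono (wave_map \<phi>)"
    by (intro monoI) (metis order_le_less)
  show "wave_map \<phi> y \<le> wave_map \<phi> x + a * K * (y - x)" if "x \<le> y" for x y
    using *[of x y] that by (cases "x = y") auto
qed

section \<open>Invariance of the exponential barriers\<close>

text \<open>\<open>b\<close> lies below its tangent \<open>p * u\<close>, and the delay is at least
  \<open>\<tau> 0\<close>; hence \<open>nonlin\<close> is dominated by its linearization on
  \<open>exp (l x)\<close>, which the linearized wave map fixes because \<open>l\<close> is a
  root.\<close>

lemma trapped_le:
  assumes "\<And>x. \<phi> x \<le> exp (l * x)"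
  shows "wave_map \<phi> x \<le> exp (l * x)"
proof -
  have "nonlin \<phi> s \<le> 1 * ((a + l) * (a + c - l)) * exp (l * s) + 0 * ((a + l) * (a + c - l)) * exp (l * s)" for s
  proof -
    have "\<phi> (s - c * \<tau> (\<phi> s)) \<le> \<phi> (s - c * \<tau> 0)"
      using c tau_mono[of 0 "\<phi> s"] by (intro admissibleD) (auto intro: admissibleD)
    also have "\<dots> \<le> exp (l * (s - c * \<tau> 0))" by (rule assms)
    also have "\<dots> = exp (- l * c * \<tau> 0) * exp (l * s)"
      by (simp add: algebra_simps flip: exp_add)
    finally have "p * \<phi> (s - c * \<tau> (\<phi> s)) \<le> p * (exp (- l * c * \<tau> 0) * exp (l * s))"
      using p by (rule mult_left_mono)
    moreover have "b (\<phi> (s - c * \<tau> (\<phi> s))) \<le> p * \<phi> (s - c * \<tau> (\<phi> s))"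
      by (intro b_le admissibleD)
    moreover have "(a * (a + c) - d) * \<phi> s \<le> (a * (a + c) - d) * exp (l * s)"
      using symbol_nonneg assms by (rule mult_left_mono[rotated])
    ultimately show ?thesis
      unfolding nonlin_def symbol_eq char_l by (simp add: algebra_simps)
  qed
  from resolvent_le[OF a ac nonlin_continuous nonlin_abs _ _ _ _ this]
  show ?thesis unfolding wave_map_def using a c l e by simp
qed

text \<open>For \<open>s \<ge> 0\<close> the required lower bound is nonpositive by
  \<open>q_symbol\<close>. For \<open>s < 0\<close> the quadratic error of \<open>b\<close> and the
  state dependence of the delay cost order \<open>exp (2 * l * s)\<close>, and the negative value of
  the characteristic function at \<open>e\<close> pays for both.\<close>

lemma trapped_ge:
  assumes "trapped \<phi>"
  shows "exp (l * x) - q * exp (e * x) \<le> wave_map \<phi> x"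
proof -
  define w where "w = (\<lambda>s. exp (l * s) - q * exp (e * s))"
  have w: "w s \<le> \<phi> s" "\<phi> s \<le> exp (l * s)" for s
    using assms by (auto simp: trapped_def w_def)
  have "1 * ((a + l) * (a + c - l)) * exp (l * s) + - q * ((a + e) * (a + c - e)) * exp (e * s) \<le> nonlin \<phi> s" for s
  proof (cases "s \<ge> 0")
    case True
    have "l * s \<le> e * s" using True e by (intro mult_right_mono) auto
    moreover have "0 \<le> (a + l) * (a + c - l)" using l c a by auto
    ultimately have "(a + l) * (a + c - l) * exp (l * s) \<le> q * ((a + e) * (a + c - e)) * exp (e * s)"
      using order_trans[OF _ q_symbol] by (intro mult_mono[OF q_symbol]) auto
    then show ?thesis using nonlin_range(1)[of s] by simp
  next
    case False
    define m where "m = \<tau> 0"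
    define E where "E = exp (l * s)"
    define t where "t = s - c * \<tau> (\<phi> s)"
    define C where "C = p * l * c + L"
    have \<tau>: "m \<le> \<tau> (\<phi> s)" "\<tau> (\<phi> s) \<le> m + E"
      using tau_mono[of 0 "\<phi> s"] tau_lipschitz[of 0 "\<phi> s"] admissibleD(4)[of s] w(2)[of s]
      by (auto simp: m_def E_def)
    have t: "t \<le> s - c * m" "s - c * m - c * E \<le> t" "t \<le> s"
      using mult_left_mono[OF \<tau>(1), of c] mult_left_mono[OF \<tau>(2), of c] c
        tau_nonneg[OF admissibleD(4)[of s]] by (auto simp: t_def algebra_simps)
    \<comment> \<open>The delay exceeds its value at 0 by at most \<open>E\<close>, as
      \<open>\<tau>\<close> is 1-Lipschitz and \<open>\<phi> s \<le> E\<close>; the first-order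
      bound on the exponential turns this into a loss of order \<open>E\<^sup>2\<close>.\<close>
    have "exp (l * (s - c * m)) * (1 - l * c * E) \<le> exp (l * (s - c * m)) * exp (- (l * c * E))"
      using exp_ge_add_one_self[of "- (l * c * E)"] by (intro mult_left_mono) auto
    also have "\<dots> = exp (l * (s - c * m - c * E))"
      by (simp add: algebra_simps flip: exp_add)
    also have "\<dots> \<le> exp (l * t)" using t l by simp
    finally have 1: "exp (l * (s - c * m)) - exp (l * (s - c * m)) * (l * c * E) \<le> exp (l * t)"
      by (simp add: algebra_simps)
    have "s - c * m \<le> s" using c tau_0 by (simp add: m_def)
    then have "exp (l * (s - c * m)) \<le> E" unfolding E_def using l by simp
    then have "exp (l * (s - c * m)) * (l * c * E) \<le> E * (l * c * E)"
      using l c by (intro mult_right_mono) (auto simp: E_def)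
    with 1 have 2: "exp (l * (s - c * m)) - l * c * E\<^sup>2 \<le> exp (l * t)"
      by (simp add: power2_eq_square mult_ac)
    have "exp (e * t) \<le> exp (e * (s - c * m))"
      using t e l by (simp only: exp_le_cancel_iff) (intro mult_left_mono, auto)
    then have 3: "q * exp (e * t) \<le> q * exp (e * (s - c * m))"
      using q by (rule mult_left_mono)
    have "exp (l * (s - c * m)) - q * exp (e * (s - c * m)) - l * c * E\<^sup>2 \<le> \<phi> t"
      using 2 3 w(1)[of t] unfolding w_def by linarith
    then have 4: "p * (exp (l * (s - c * m)) - q * exp (e * (s - c * m)) - l * c * E\<^sup>2) \<le> p * \<phi> t"
      using p by (rule mult_left_mono)
    have "\<phi> t \<le> E" using admissibleD(2)[OF t(3)] w(2)[of s] by (simp add: E_def)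
    then have "(\<phi> t)\<^sup>2 \<le> E\<^sup>2" using admissibleD(4) by (rule power_mono)
    then have 5: "L * (\<phi> t)\<^sup>2 \<le> L * E\<^sup>2" using L by (rule mult_left_mono)
    have 6: "p * \<phi> t - L * (\<phi> t)\<^sup>2 \<le> b (\<phi> t)" by (intro b_ge admissibleD)
    have 7: "(a * (a + c) - d) * w s \<le> (a * (a + c) - d) * \<phi> s"
      using symbol_nonneg w by (intro mult_left_mono) auto
    \<comment> \<open>Here \<open>e \<le> 2 * l\<close> enters: for negative \<open>s\<close> the
      errors of order \<open>E\<^sup>2\<close> decay at least as fast as
      \<open>exp (e * s)\<close>.\<close>
    have "E\<^sup>2 = exp (2 * l * s)" by (simp add: E_def power2_eq_square flip: exp_add)
    also have "\<dots> \<le> exp (e * s)" using False e by (simp add: mult_right_mono_neg)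
    finally have "E\<^sup>2 \<le> exp (e * s)" .
    moreover have C: "0 \<le> C" "C \<le> - q * char_fun d p m e c"
      using q_char p l c L by (simp_all add: C_def m_def)
    ultimately have "C * E\<^sup>2 \<le> - q * char_fun d p m e c * exp (e * s)"
      using order_trans[OF C] by (intro mult_mono) auto
    then have 8: "0 \<le> - q * char_fun d p m e c * exp (e * s) - C * E\<^sup>2" by simp
    define B X Y F \<gamma> where "B = a * (a + c) - d" and "X = exp (- l * c * m)" and "Y = exp (- e * c * m)"
      and "F = exp (e * s)" and "\<gamma> = char_fun d p m e c"
    have XY: "exp (l * (s - c * m)) = X * E" "exp (e * (s - c * m)) = Y * F"
      by (simp_all add: X_def Y_def E_def F_def algebra_simps flip: exp_add)
    have "1 * ((a + l) * (a + c - l)) * exp (l * s) + - q * ((a + e) * (a + c - e)) * exp (e * s)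
       = (B + p * X) * E - q * (B + p * Y - \<gamma>) * F"
      unfolding symbol_eq char_l by (simp add: B_def X_def Y_def E_def F_def \<gamma>_def m_def)
    \<comment> \<open>The first two summands bound the two terms of \<open>nonlin \<phi> s\<close>
      from below; the subtracted bracket is the surplus, nonnegative by fact
      \<open>8\<close>.\<close>
    also have "\<dots> = B * (E - q * F) + (p * (X * E - q * (Y * F) - l * c * E\<^sup>2) - L * E\<^sup>2)
       - (- q * \<gamma> * F - C * E\<^sup>2)"
      by (simp add: C_def algebra_simps)
    also have "\<dots> \<le> B * \<phi> s + b (\<phi> t)"
      using 4 5 6 7 8 unfolding XY w_def B_def[symmetric] E_def[symmetric] F_def[symmetric] \<gamma>_def[symmetric]
      by linarith
    also have "\<dots> = nonlin \<phi> s" by (simp add: nonlin_def B_def t_def)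
    finally show ?thesis .
  qed
  from resolvent_ge[OF a ac nonlin_continuous nonlin_abs _ _ _ _ this]
  show ?thesis unfolding wave_map_def using a c l e by simp
qed

end

section \<open>Monotonicity of the wave map and the largest profile\<close>

lemma wave_map_le:
  assumes "admissible \<phi>" "admissible \<psi>" "\<And>x. \<phi> x \<le> \<psi> x"
  shows "wave_map \<phi> x \<le> wave_map \<psi> x"
  unfolding wave_map_def using assms a c
  by (intro resolvent_mono[where C = "a * (a + c) * K" and D = "a * (a + c) * K"])
    (auto intro!: nonlin_continuous nonlin_abs nonlin_le)

definition supersolution :: "real \<Rightarrow> real" where
  "supersolution x = min K (exp (l * x))"

text \<open>Below the level \<open>K\<close> the exponential has slope at most \<open>l * K\<close>,
  and \<open>l \<le> a\<close>. The Lipschitz bound comes from \<open>exp (- h) \<ge> 1 - h\<close>,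
  so the kink of the minimum causes no case distinction.\<close>

lemma supersolution_admissible: "admissible supersolution"
  unfolding admissible_def
proof (intro conjI allI impI monoI)
  fix x y :: real assume xy: "x \<le> y"
  then have "exp (l * x) \<le> exp (l * y)" using l by simp
  then show "supersolution x \<le> supersolution y" 
    unfolding supersolution_def by (intro min.mono order_refl)
  define u where "u = supersolution y"
  have u: "0 \<le> u" "u \<le> K" "u \<le> exp (l * y)" using K by (auto simp: u_def supersolution_def)
  have "l * (y - x) * u \<le> a * (y - x) * K"
    using u l xy a by (intro mult_mono) auto
  then have 1: "u * (1 - l * (y - x)) \<ge> u - a * K * (y - x)" by (simp add: algebra_simps)
  have "u * (1 + - (l * (y - x))) \<le> u * exp (- (l * (y - x)))"
    using u(1) exp_ge_add_one_self[of "- (l * (y - x))"] by (intro mult_left_mono) auto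
  also have "\<dots> \<le> exp (l * y) * exp (- (l * (y - x)))"
    using u(3) by (intro mult_right_mono) auto
  also have "\<dots> = exp (l * x)" by (simp add: algebra_simps flip: exp_add)
  finally have "u - a * K * (y - x) \<le> exp (l * x)" using 1 by simp
  moreover have "0 \<le> a * K * (y - x)" using a K xy by simp
  then have "u - a * K * (y - x) \<le> K" using u by linarith
  ultimately have "u - a * K * (y - x) \<le> supersolution x"
    by (simp add: supersolution_def)
  then show "supersolution y \<le> supersolution x + a * K * (y - x)" by (simp add: u_def)
qed (use K in \<open>auto simp: supersolution_def\<close>)

text \<open>Where the minimum switches to \<open>K\<close>, the lower barrier is already nonpositive
  by \<open>q_cutoff\<close>.\<close>

lemma supersolution_trapped: "trapped supersolution"
  unfolding trapped_def
proof (intro allI conjI)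
  fix x
  have "q * exp (e * x) \<ge> 0" using q by simp
  moreover have "exp (l * x) - q * exp (e * x) \<le> K"
  proof (cases "K \<le> exp (l * x)")
    case True
    from q_cutoff[OF this] show ?thesis using K by linarith
  qed (use \<open>q * exp (e * x) \<ge> 0\<close> in linarith)
  ultimately show "exp (l * x) - q * exp (e * x) \<le> supersolution x"
    by (simp add: supersolution_def)
qed (simp add: supersolution_def)

lemma wave_map_supersolution: "wave_map supersolution x \<le> supersolution x"
  using trapped_le[OF supersolution_admissible] wave_map_admissible[OF supersolution_admissible]
  by (auto simp: supersolution_def admissible_def)

lemma wave_map_trapped: "admissible \<phi> \<Longrightarrow> trapped \<phi> \<Longrightarrow> trapped (wave_map \<phi>)"
  using trapped_le[of \<phi>] trapped_ge[of \<phi>] by (auto simp: trapped_def)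

subsection \<open>The fixed point and its limits\<close>

text \<open>The fixed point is the pointwise infimum of all trapped admissible profiles that the
  wave map does not raise. The defining inequalities pass to infima, and
  \<open>supersolution\<close> makes the family nonempty.\<close>

lemma wave_map_fixed_point: "\<exists>\<phi>. admissible \<phi> \<and> trapped \<phi> \<and> wave_map \<phi> = \<phi>"
proof -
  define Q where "Q = {\<phi>. admissible \<phi> \<and> trapped \<phi> \<and> (\<forall>x. wave_map \<phi> x \<le> \<phi> x)}"
  define \<phi> where "\<phi> = (\<lambda>x. INF \<psi>\<in>Q. \<psi> x)"
  have top: "supersolution \<in> Q"
    by (simp add: Q_def supersolution_admissible supersolution_trapped wave_map_supersolution)
  have adm: "admissible \<psi>" and trap: "trapped \<psi>" if "\<psi> \<in> Q" for \<psi>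
    using that by (auto simp: Q_def)
  have bdd: "bdd_below ((\<lambda>\<psi>. \<psi> x) ` Q)" for x
    using adm by (intro bdd_belowI[of _ 0]) (auto simp: admissible_def)
  have le: "\<phi> x \<le> \<psi> x" if "\<psi> \<in> Q" for \<psi> x
    unfolding \<phi>_def using bdd that by (rule cINF_lower)
  have ge: "y \<le> \<phi> x" if "\<And>\<psi>. \<psi> \<in> Q \<Longrightarrow> y \<le> \<psi> x" for x y
    unfolding \<phi>_def using top that by (intro cINF_greatest) auto
  have "admissible \<phi>"
    unfolding admissible_def
  proof (intro conjI allI impI monoI)
    fix x y :: real assume xy: "x \<le> y"
    show "\<phi> x \<le> \<phi> y"
      using xy by (intro ge) (meson adm admissibleD(2) le order_trans)
    have "\<phi> y - a * K * (y - x) \<le> \<phi> x"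
    proof (rule ge)
      fix \<psi> assume "\<psi> \<in> Q"
      then show "\<phi> y - a * K * (y - x) \<le> \<psi> x"
        using le[of \<psi> y] admissibleD(3)[OF adm xy, of \<psi>] by simp
    qed
    then show "\<phi> y \<le> \<phi> x + a * K * (y - x)" by simp
  next
    show "0 \<le> \<phi> x" for x by (intro ge admissibleD(4) adm)
    show "\<phi> x \<le> K" for x using le[OF top, of x] by (simp add: supersolution_def)
  qed
  moreover have "trapped \<phi>"
    unfolding trapped_def
  proof (intro conjI allI)
    show "exp (l * x) - q * exp (e * x) \<le> \<phi> x" for x
      using trap by (intro ge) (auto simp: trapped_def)
    show "\<phi> x \<le> exp (l * x)" for x using le[OF top, of x] by (simp add: supersolution_def)
  qed
  moreover have down: "wave_map \<phi> x \<le> \<phi> x" for x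
  proof (rule ge)
    fix \<psi> assume "\<psi> \<in> Q"
    then have "wave_map \<phi> x \<le> wave_map \<psi> x"
      by (intro wave_map_le[OF \<open>admissible \<phi>\<close> adm[OF \<open>\<psi> \<in> Q\<close>]] le[OF \<open>\<psi> \<in> Q\<close>])
    also have "\<dots> \<le> \<psi> x" using \<open>\<psi> \<in> Q\<close> by (simp add: Q_def)
    finally show "wave_map \<phi> x \<le> \<psi> x" .
  qed
  \<comment> \<open>The image is itself a member of the family, hence lies above the infimum
    \<open>\<phi>\<close>; this is the missing inequality.\<close>
  ultimately have "wave_map \<phi> \<in> Q"
    by (auto simp: Q_def intro!: wave_map_admissible wave_map_trapped wave_map_le)
  then have "wave_map \<phi> = \<phi>"
    using down le by (intro ext antisym)
  with \<open>admissible \<phi>\<close> \<open>trapped \<phi>\<close> show ?thesis by blast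
qed

lemma trapped_limit_at_bot:
  assumes "admissible \<phi>" "trapped \<phi>"
  shows "(\<phi> \<longlongrightarrow> 0) at_bot"
proof (rule tendsto_sandwich[where f = "\<lambda>_. 0"])
  show "((\<lambda>x. exp (l * x)) \<longlongrightarrow> 0) at_bot"
    using l by (intro filterlim_compose[OF exp_at_bot]
      filterlim_tendsto_pos_mult_at_bot[OF tendsto_const] filterlim_ident)
qed (use assms in \<open>auto simp: admissible_def trapped_def\<close>)

text \<open>If the limit \<open>k\<close> were below \<open>K\<close>, then \<open>\<phi>' - c \<phi>\<close> would eventually decrease at the linear rate
  \<open>b k - d k > 0\<close>, although it is bounded below by \<open>- c K\<close>.\<close>

lemma fixed_point_limit_at_top:
  assumes adm: "admissible \<phi>" and trap: "trapped \<phi>" and fp: "wave_map \<phi> = \<phi>"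
  shows "(\<phi> \<longlongrightarrow> K) at_top"
proof -
  define k where "k = (SUP x. \<phi> x)"
  have bdd: "bdd_above (range \<phi>)"
    using admissibleD(5)[OF adm] by (intro bdd_aboveI[of _ K]) auto
  have le: "\<phi> x \<le> k" for x
    unfolding k_def by (rule cSUP_upper[OF _ bdd]) simp
  have "k \<le> K"
    unfolding k_def using admissibleD(5)[OF adm] by (intro cSUP_least) auto
  have lim: "(\<phi> \<longlongrightarrow> k) at_top"
  proof (rule order_tendstoI)
    fix y assume "y < k"
    then obtain x where "y < \<phi> x"
      unfolding k_def using less_cSUP_iff[OF _ bdd] by auto
    then have "y < \<phi> z" if "z \<ge> x" for z
      using admissibleD(2)[OF adm that] by simp
    then show "\<forall>\<^sub>F x in at_top. y < \<phi> x"
      by (auto simp: eventually_at_top_linorder)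
  next
    fix y assume "k < y"
    then show "\<forall>\<^sub>F x in at_top. \<phi> x < y"
      using le by (intro always_eventually) (auto intro: le_less_trans)
  qed
  have "k > 0"
  proof -
    \<comment> \<open>At this point \<open>e * x = l * x - q\<close>, so the lower barrier equals
      \<open>exp (l * x) * (1 - q * exp (- q))\<close>, positive because
      \<open>q < exp q\<close>.\<close>
    define x where "x = - q / (e - l)"
    have "q < exp q" using exp_ge_add_one_self[of q] by linarith
    then have "q * exp (- q) < 1" by (simp add: exp_minus field_simps)
    moreover have "(e - l) * x = - q" using e by (simp add: x_def)
    then have "e * x = l * x + - q" by (simp add: algebra_simps)
    then have "exp (e * x) = exp (l * x) * exp (- q)" by (simp only: exp_add)
    ultimately have "exp (l * x) * (q * exp (- q)) < exp (l * x) * 1"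
      by (intro mult_strict_left_mono) auto
    then have "0 < exp (l * x) - q * exp (e * x)"
      using \<open>exp (e * x) = _\<close> by (simp add: mult_ac)
    then show ?thesis using le[of x] trap unfolding trapped_def by (meson less_le_trans)
  qed
  have "\<not> k < K"
  proof
    assume "k < K"
    define \<delta> where "\<delta> = (b k - d * k) / 2"
    have "\<delta> > 0" using b_gt[OF \<open>k > 0\<close> \<open>k < K\<close>] by (simp add: \<delta>_def)
    \<comment> \<open>Since \<open>\<phi> \<le> K\<close>, the shift is at most
      \<open>c * \<tau> K\<close>, so the delayed argument also tends to infinity.\<close>
    have "filterlim (\<lambda>x. - (c * \<tau> K) + x) at_top at_top"
      by (rule filterlim_tendsto_add_at_top[OF tendsto_const filterlim_ident])
    then have "filterlim (\<lambda>x. x - c * \<tau> (\<phi> x)) at_top at_top"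
      by (rule filterlim_at_top_mono)
        (use c in \<open>auto intro!: always_eventually tau_mono admissibleD[OF adm]\<close>)
    then have "((\<lambda>x. \<phi> (x - c * \<tau> (\<phi> x))) \<longlongrightarrow> k) at_top"
      by (rule filterlim_compose[OF lim])
    moreover have "continuous_on {0..K} b"
      using p by (rule continuous_on_mono_lipschitz) (auto intro: b_mono b_lipschitz)
    ultimately have "((\<lambda>x. b (\<phi> (x - c * \<tau> (\<phi> x)))) \<longlongrightarrow> b k) at_top"
      using \<open>k > 0\<close> \<open>k \<le> K\<close>
      by (intro continuous_on_tendsto_compose[where f = b]) (auto intro!: always_eventually admissibleD[OF adm])
    then have "((\<lambda>x. d * \<phi> x - b (\<phi> (x - c * \<tau> (\<phi> x)))) \<longlongrightarrow> d * k - b k) at_top"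
      using lim by (intro tendsto_intros)
    moreover have "d * k - b k < - \<delta>" using \<open>\<delta> > 0\<close> by (simp add: \<delta>_def field_simps)
    ultimately have "\<forall>\<^sub>F x in at_top. d * \<phi> x - b (\<phi> (x - c * \<tau> (\<phi> x))) < - \<delta>"
      by (rule order_tendstoD)
    then obtain x where x: "d * \<phi> z - b (\<phi> (z - c * \<tau> (\<phi> z))) < - \<delta>" if "z \<ge> x" for z
      by (auto simp: eventually_at_top_linorder)
    define g where "g = (\<lambda>z. wave_slope \<phi> z - c * \<phi> z)"
    have g_ge: "- c * K \<le> g z" for z
    proof -
      have "c * \<phi> z \<le> c * K" using c by (intro mult_left_mono admissibleD[OF adm]) auto
      then show ?thesis using wave_slope_range(1)[OF adm, of z] by (simp add: g_def)
    qed
    have g: "(g has_real_derivative d * \<phi> z - b (\<phi> (z - c * \<tau> (\<phi> z)))) (at z)" for z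
    proof -
      have "(g has_real_derivative
          c * wave_slope \<phi> z + a * (a + c) * wave_map \<phi> z - nonlin \<phi> z - c * wave_slope \<phi> z) (at z)"
        unfolding g_def using wave_map_deriv[OF adm, of z]
        by (intro DERIV_diff wave_slope_deriv[OF adm] DERIV_cmult) (simp add: fp)
      then show ?thesis by (simp add: fp nonlin_def algebra_simps)
    qed
    \<comment> \<open>Descending at rate \<open>\<delta>\<close> from \<open>x\<close> to
      \<open>y\<close> costs \<open>g x + c * K + 1\<close>, one more than the lower bound on
      \<open>g\<close> allows.\<close>
    define y where "y = x + (g x + c * K + 1) / \<delta>"
    have "x < y" using g_ge[of x] \<open>\<delta> > 0\<close> by (simp add: y_def)
    then obtain z where z: "z > x" "g y - g x = (y - x) * (d * \<phi> z - b (\<phi> (z - c * \<tau> (\<phi> z))))"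
      using MVT2[OF _ g] by blast
    then have "g y - g x \<le> (y - x) * (- \<delta>)"
      using x[of z] \<open>x < y\<close> by (simp only:) (intro mult_left_mono, auto)
    also have "\<dots> = - (g x + c * K + 1)" using \<open>\<delta> > 0\<close> by (simp add: y_def)
    finally show False using g_ge[of y] by simp
  qed
  with \<open>k \<le> K\<close> lim show ?thesis by simp
qed

lemma travelling_wave:
  "\<exists>\<phi> \<phi>' \<phi>'' :: real \<Rightarrow> real.
    mono \<phi> \<and>
    (\<forall>\<xi>. (\<phi> has_real_derivative \<phi>' \<xi>) (at \<xi>)) \<and>
    (\<forall>\<xi>. (\<phi>' has_real_derivative \<phi>'' \<xi>) (at \<xi>)) \<and>
    continuous_on UNIV \<phi>'' \<and>
    (\<forall>\<xi>. \<phi>'' \<xi> - c * \<phi>' \<xi> - d * \<phi> \<xi> + b (\<phi> (\<xi> - c * \<tau> (\<phi> \<xi>))) = 0) \<and>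
    (\<phi> \<longlongrightarrow> 0) at_bot \<and> (\<phi> \<longlongrightarrow> K) at_top"
proof -
  obtain \<phi> where adm: "admissible \<phi>" and trap: "trapped \<phi>" and fp: "wave_map \<phi> = \<phi>"
    using wave_map_fixed_point by blast
  \<comment> \<open>The second derivative is read off the wave equation, which reduces its
    continuity to that of the other terms.\<close>
  define \<phi>'' where "\<phi>'' = (\<lambda>x. c * wave_slope \<phi> x + d * \<phi> x - b (\<phi> (x - c * \<tau> (\<phi> x))))"
  have 1: "(\<phi> has_real_derivative wave_slope \<phi> x) (at x)" for x
    using wave_map_deriv[OF adm, of x] by (simp add: fp)
  have 2: "(wave_slope \<phi> has_real_derivative \<phi>'' x) (at x)" for x
    using wave_slope_deriv[OF adm, of x] by (simp add: fp \<phi>''_def nonlin_def algebra_simps)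
  have "continuous_on UNIV (wave_slope \<phi>)"
    using 2 by (intro DERIV_continuous_on) auto
  then have "continuous_on UNIV \<phi>''"
    unfolding \<phi>''_def
    by (intro continuous_intros birth_continuous[OF adm] admissible_continuous[OF adm])
  then show ?thesis
    using 1 2 admissibleD(1)[OF adm] trapped_limit_at_bot[OF adm trap]
      fixed_point_limit_at_top[OF adm trap fp]
    by (intro exI[of _ \<phi>] exI[of _ "wave_slope \<phi>"] exI[of _ \<phi>'']) (auto simp: \<phi>''_def)
qed

end

section \<open>Choice of the constants from the derivative hypotheses\<close>

text \<open>The mean value theorem with derivatives taken within \<open>S\<close>, since
  \<open>b\<close> and \<open>\<tau>\<close> have only one-sided derivatives at the ends of their
  domains.\<close>

lemma mono_lipschitz_of_deriv:
  fixes f :: "real \<Rightarrow> real"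
  assumes "\<And>x. x \<in> S \<Longrightarrow> (f has_real_derivative f' x) (at x within S)"
    "\<And>x. x \<in> S \<Longrightarrow> 0 \<le> f' x \<and> f' x \<le> k" "{u..v} \<subseteq> S" "u \<le> v"
  shows "f u \<le> f v" "f v \<le> f u + k * (v - u)"
proof -
  have "f u \<le> f v \<and> f v \<le> f u + k * (v - u)"
  proof (cases "u = v")
    case False
    have "(f has_derivative (\<lambda>h. f' x * h)) (at x within {u..v})" if "u \<le> x" "x \<le> v" for x
    proof -
      have "(f has_real_derivative f' x) (at x within {u..v})"
        using that assms(3) by (intro has_field_derivative_subset[OF assms(1) assms(3)]) auto
      then show ?thesis by (simp add: has_field_derivative_def)
    qed
    then obtain z where z: "z \<in> {u<..<v}" "f v - f u = f' z * (v - u)"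
      using mvt_simple[of u v f "\<lambda>x h. f' x * h"] assms(4) False by auto
    then have "z \<in> S" using assms(3) by auto
    then have "0 \<le> f' z * (v - u)" "f' z * (v - u) \<le> k * (v - u)"
      using assms(2)[of z] assms(4) by (auto intro: mult_right_mono)
    with z(2) show ?thesis by linarith
  qed simp
  then show "f u \<le> f v" "f v \<le> f u + k * (v - u)" by auto
qed

theorem theorem2p14:
  fixes d K L M c :: real
    and b b' \<tau> \<tau>' :: "real \<Rightarrow> real"
  assumes d_pos: "d > 0" and K_pos: "K > 0"
    and b_nonneg: "\<forall>u\<ge>0. b u \<ge> 0"
    and b_zero: "b 0 = 0" and b_K: "b K = d * K"
    and b_below_K: "\<forall>u\<in>{0<..<K}. b u > d * u"
    and b_above_K: "\<forall>u>K. 0 < b u \<and> b u < d * u"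
    and tau_nonneg: "\<forall>u\<ge>0. \<tau> u \<ge> 0"
    and tau_deriv: "\<forall>u\<ge>0. (\<tau> has_real_derivative \<tau>' u) (at u within {0..})"
    and tau_C1: "continuous_on {0..} \<tau>'"
    and tau_deriv_bounds: "\<forall>u\<ge>0. 0 \<le> \<tau>' u \<and> \<tau>' u < 1"
    and tau_lim: "(\<tau> \<longlongrightarrow> M) at_top" and tau_zero_le: "\<tau> 0 \<le> M"
    and b_deriv: "\<forall>u\<in>{0..K}. (b has_real_derivative b' u) (at u within {0..K})"
    and b_C1: "continuous_on {0..K} b'"
    and b'_zero: "b' 0 > d"
    and b_sublinear: "\<forall>u\<in>{0<..K}. b u < b' 0 * u"
    and b'_bounds: "\<forall>u\<in>{0..K}. 0 \<le> b' u \<and> b' u \<le> b' 0"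
    and L_pos: "L > 0"
    and b_quadratic: "\<forall>u\<in>{0<..K}. 0 \<le> b' 0 * u - b u \<and> b' 0 * u - b u < L * u\<^sup>2"
    and c_gt: "c > critical_speed d (b' 0) (\<tau> 0)"
  shows "\<exists>\<phi> \<phi>' \<phi>'' :: real \<Rightarrow> real.
    mono \<phi> \<and>
    (\<forall>\<xi>. (\<phi> has_real_derivative \<phi>' \<xi>) (at \<xi>)) \<and>
    (\<forall>\<xi>. (\<phi>' has_real_derivative \<phi>'' \<xi>) (at \<xi>)) \<and>
    continuous_on UNIV \<phi>'' \<and>
    (\<forall>\<xi>. \<phi>'' \<xi> - c * \<phi>' \<xi> - d * \<phi> \<xi> + b (\<phi> (\<xi> - c * \<tau> (\<phi> \<xi>))) = 0) \<and>
    (\<phi> \<longlongrightarrow> 0) at_bot \<and> (\<phi> \<longlongrightarrow> K) at_top"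
proof -
  define p m where "p = b' 0" and "m = \<tau> 0"
  have m: "m \<ge> 0" using tau_nonneg by (simp add: m_def)
  have p: "p > d" "p > 0" using b'_zero d_pos by (auto simp: p_def)
  have crit: "is_critical_speed d p m (critical_speed d p m)"
    using critical_speed_is_critical[OF d_pos p(1) m] .
  have cgt: "c > critical_speed d p m" using c_gt by (simp add: p_def m_def)
  have c: "c > 0" using crit cgt by (simp add: is_critical_speed_def)
  from crit cgt obtain l1 l2 where l: "0 < l1" "l1 < l2"
      and roots: "{l. l > 0 \<and> char_fun d p m l c = 0} = {l1, l2}"
      and neg: "\<forall>l\<in>{l1<..<l2}. char_fun d p m l c < 0"
    unfolding is_critical_speed_def by metis
  have root: "char_fun d p m l1 c = 0" using roots by blast
  \<comment> \<open>Lying strictly between the roots makes the characteristic function negative at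
    \<open>e\<close>; the cap \<open>2 * l1\<close> lets \<open>exp (e * s)\<close> dominate the
    quadratic errors for negative \<open>s\<close>.\<close>
  define e where "e = min (2 * l1) ((l1 + l2) / 2)"
  have e: "l1 < e" "e \<le> 2 * l1" "e < l2" using l by (auto simp: e_def min_def)
  define \<gamma> where "\<gamma> = char_fun d p m e c"
  have \<gamma>: "\<gamma> < 0" using neg e by (simp add: \<gamma>_def)
  \<comment> \<open>The summand \<open>l2\<close> secures \<open>l1 \<le> a\<close> and
    \<open>e < a + c\<close>, the part \<open>d + p * c * K\<close> secures the monotonicity
    condition, and 1 gives \<open>d \<le> a * d\<close>.\<close>
  define a where "a = d + p * c * K + l2 + 1"
  have pcK: "p * c * K > 0" using p c K_pos by simp
  have a: "a > 1" "l2 \<le> a" "d + p * c * K \<le> a" using pcK d_pos l by (auto simp: a_def)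
  have a_large: "d + p * c * (a * K) \<le> a * (a + c)"
  proof -
    have "d + p * c * (a * K) \<le> a * (d + p * c * K)"
      using d_pos a by (simp add: algebra_simps)
    also have "\<dots> \<le> a * (a + c)" using a c by (intro mult_left_mono) auto
    finally show ?thesis .
  qed
  define D where "D = (a + e) * (a + c - e)"
  have D: "D > 0" using a e c l unfolding D_def by (intro mult_pos_pos) auto
  \<comment> \<open>\<open>exp (l1 * x)\<close> reaches \<open>K\<close> at \<open>x0\<close>. The
    values \<open>q1\<close>, \<open>q2\<close>, \<open>q3\<close> are the thresholds for
    \<open>q_char\<close>, \<open>q_symbol\<close> and \<open>q_cutoff\<close>; the last is
    \<open>exp (- (e - l1) * x)\<close> at \<open>x0\<close>, its largest value on the half-line
    from \<open>x0\<close> on.\<close>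
  define x0 where "x0 = ln K / l1"
  define q1 q2 q3 where "q1 = (p * l1 * c + L) / (- \<gamma>)"
    and "q2 = (a + l1) * (a + c - l1) / D" and "q3 = exp (- (e - l1) * x0)"
  define q where "q = max q1 (max q2 q3)"
  have q: "q1 \<le> q" "q2 \<le> q" "q3 \<le> q" by (auto simp: q_def)
  have "0 < q3" by (simp add: q3_def)
  have q_char: "p * l1 * c + L \<le> - q * \<gamma>"
    using q(1) \<gamma> by (simp add: q1_def divide_simps)
  have q_symbol: "(a + l1) * (a + c - l1) \<le> q * D"
    using q(2) D by (simp add: q2_def pos_divide_le_eq)
  have q_cutoff: "exp (l1 * x) \<le> q * exp (e * x)" if "K \<le> exp (l1 * x)" for x
  proof -
    have "ln K \<le> l1 * x" using that K_pos by (metis ln_le_cancel_iff exp_gt_zero ln_exp)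
    then have "x0 \<le> x" using l by (simp add: x0_def field_simps)
    then have "(e - l1) * x0 \<le> (e - l1) * x" using e by (intro mult_left_mono) auto
    then have "exp (l1 * x) \<le> exp (- (e - l1) * x0 + e * x)"
      by (simp add: algebra_simps)
    also have "\<dots> = q3 * exp (e * x)" by (simp only: exp_add q3_def)
    also have "\<dots> \<le> q * exp (e * x)" using q(3) by (intro mult_right_mono) auto
    finally show ?thesis .
  qed
  note b_bounds = mono_lipschitz_of_deriv[where S = "{0..K}" and f = b and f' = b' and k = p]
  note \<tau>_bounds = mono_lipschitz_of_deriv[where S = "{0..}" and f = \<tau> and f' = \<tau>' and k = 1]
  interpret delayed_wave d K L p c a l1 e q b \<tau>
  proof
    show "b u \<le> b v" "b v \<le> b u + p * (v - u)" if "0 \<le> u" "u \<le> v" "v \<le> K" for u v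
      using b_bounds[of u v] b_deriv b'_bounds that by (auto simp: p_def)
    show "\<tau> u \<le> \<tau> v" "\<tau> v \<le> \<tau> u + (v - u)" if "0 \<le> u" "u \<le> v" for u v
      using \<tau>_bounds[of u v] tau_deriv tau_deriv_bounds that by (auto simp: less_imp_le)
    show "p * u - L * u\<^sup>2 \<le> b u" if "0 \<le> u" "u \<le> K" for u
      using b_quadratic[rule_format, of u] b_zero that by (cases "u = 0") (auto simp: p_def)
    show "char_fun d p (\<tau> 0) l1 c = 0" "p * l1 * c + L \<le> - q * char_fun d p (\<tau> 0) e c"
      using root q_char by (simp_all add: m_def \<gamma>_def)
  qed (use d_pos K_pos L_pos p c a l e b_zero b_K b_below_K tau_nonneg a_large q \<open>0 < q3\<close> q_symbol q_cutoff
      in \<open>auto simp: D_def\<close>)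
  show ?thesis by (rule travelling_wave)
qed

end
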